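(* The variety of superintegrable systems $\mathcal V\subset\mathbb P^9$ is, as a set, the union of the following six classes of points. For a point, write $(D,A_z,B_w)$ for its associated polynomials; parameters below are complex numbers, and the point is the one whose $(D,A_z,B_w)$ are as listed (provided not all $a_{ij}$ vanish). (1) $\mathring{\mathcal V}_{(1,1,1)}$: either $D=(a_1z+c_1)(a_2z+b_2w+c_2)(b_3w+c_3)$ with $a_1b_2c_3-a_1c_2b_3+c_1a_2b_3=0$, $a_1\neq0$, $b_3\neq0$, $A_z=a_1a_2(b_3w+c_3)^2/b_3$, $B_w=b_2b_3(a_1z+c_1)^2/a_1$; or $D=a_2z+b_2w+c_2$ with $a_2\ne0\ne b_2$, $A_z=-a_2^2/b_2$, $B_w=-b_2^2/a_2$. (2) $\mathring{\mathcal V}_{(11,0,1)}$: $D=(a_1z+c_1)(a_2z+c_2)(b_3w+c_3)$ with $b_3\neq0$, $A_z=a_1a_2(b_3w+c_3)^2/b_3$, $B_w=0$. (3) $\mathcal V_{(11,0,0)}$: $D=(a_1z+c_1)(a_2z+c_2)$, $A_z=2a_1a_2w+t$ with $t$ arbitrary, $B_w=0$. (4) $\mathring{\mathcal V}_{(0,11,0)}$: $D=(a_1z+b_1w+c_1)(a_3z+b_3w+c_3)$ with $a_1b_3+b_1a_3=0$, $a_1a_3b_1b_3\neq0$, $A_z=a_1a_3(2w+c_3/b_3+c_1/b_1)$, $B_w=b_1b_3(2z+c_3/a_3+c_1/a_1)$. (5) $\mathring{\mathcal V}_{(1,0,11)}$ and (6) $\mathcal V_{(0,0,11)}$: the images of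 classes (2) and (3), respectively, under conjugation $a_{ij}\mapsto a_{ji}$ (equivalently, exchanging $z\leftrightarrow w$ and $A_z\leftrightarrow B_w$).
   Context: Homogeneous coordinates $a_{ij}$ ($i,j\ge0$, $i+j\le3$) on $\mathbb P^9$. Associated polynomials: $D(z,w)=\sum_{0\le i,j\le2,(i,j)\ne(2,2)}a_{ij}z^iw^j$, $A_z(w)=a_{21}w^2+2a_{20}w+a_{30}$, $B_w(z)=a_{12}z^2+2a_{02}z+a_{03}$ (names of polynomials; subscripts on $D$ denote partial derivatives). The variety of superintegrable systems $\mathcal V$ is the set of points satisfying the Plücker relations $a_{03}a_{21}-a_{02}a_{11}+a_{01}a_{12}=0$, $a_{03}a_{20}-a_{02}a_{10}+a_{00}a_{12}=0$, $a_{03}a_{30}-a_{01}a_{10}+a_{00}a_{11}=0$, $a_{02}a_{30}-a_{01}a_{20}+a_{00}a_{21}=0$, $a_{12}a_{30}-a_{11}a_{20}+a_{10}a_{21}=0$ and the superintegrability conditions, i.e. the polynomial identities in $z,w$: $3A_zDD_{ww}-2A_zB_wD_z-2A_zD_w^2+DD_wD_{zz}=0$, $3B_wDD_{zz}-2A_zB_wD_w-2B_wD_z^2+DD_zD_{ww}=0$, $2D^2D_{zz}D_{ww}-B_wDD_zD_{zz}-A_zDD_wD_{ww}-A_zB_wD_zD_w+A_z^2B_w^2=0$. *)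

theory Defs
  imports Complex_Main
begin

text \<open>A point of P^9 is represented by a coefficient function a with a i j = a_ij;
  only the entries with i + j \<le> 3 are ever used.\<close>

type_synonym coeffs = "nat \<Rightarrow> nat \<Rightarrow> complex"

definition nonzero_pt :: "coeffs \<Rightarrow> bool" where
  "nonzero_pt a \<longleftrightarrow> (\<exists>i j. i + j \<le> 3 \<and> a i j \<noteq> 0)"

definition Dp :: "coeffs \<Rightarrow> complex \<Rightarrow> complex \<Rightarrow> complex" where
  "Dp a z w = a 0 0 + a 1 0 * z + a 0 1 * w + a 2 0 * z^2 + a 1 1 * z * w + a 0 2 * w^2
              + a 2 1 * z^2 * w + a 1 2 * z * w^2"

definition Dz :: "coeffs \<Rightarrow> complex \<Rightarrow> complex \<Rightarrow> complex" where
  "Dz a z w = a 1 0 + 2 * a 2 0 * z + a 1 1 * w + 2 * a 2 1 * z * w + a 1 2 * w^2"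

definition Dw :: "coeffs \<Rightarrow> complex \<Rightarrow> complex \<Rightarrow> complex" where
  "Dw a z w = a 0 1 + a 1 1 * z + 2 * a 0 2 * w + a 2 1 * z^2 + 2 * a 1 2 * z * w"

definition Dzz :: "coeffs \<Rightarrow> complex \<Rightarrow> complex \<Rightarrow> complex" where
  "Dzz a z w = 2 * a 2 0 + 2 * a 2 1 * w"

definition Dww :: "coeffs \<Rightarrow> complex \<Rightarrow> complex \<Rightarrow> complex" where
  "Dww a z w = 2 * a 0 2 + 2 * a 1 2 * z"

definition Az :: "coeffs \<Rightarrow> complex \<Rightarrow> complex" where
  "Az a w = a 2 1 * w^2 + 2 * a 2 0 * w + a 3 0"

definition Bw :: "coeffs \<Rightarrow> complex \<Rightarrow> complex" where
  "Bw a z = a 1 2 * z^2 + 2 * a 0 2 * z + a 0 3"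

definition pluecker :: "coeffs \<Rightarrow> bool" where
  "pluecker a \<longleftrightarrow>
     a 0 3 * a 2 1 - a 0 2 * a 1 1 + a 0 1 * a 1 2 = 0 \<and>
     a 0 3 * a 2 0 - a 0 2 * a 1 0 + a 0 0 * a 1 2 = 0 \<and>
     a 0 3 * a 3 0 - a 0 1 * a 1 0 + a 0 0 * a 1 1 = 0 \<and>
     a 0 2 * a 3 0 - a 0 1 * a 2 0 + a 0 0 * a 2 1 = 0 \<and>
     a 1 2 * a 3 0 - a 1 1 * a 2 0 + a 1 0 * a 2 1 = 0"

definition superint_conds :: "coeffs \<Rightarrow> bool" where
  "superint_conds a \<longleftrightarrow> (\<forall>z w.
     3 * Az a w * Dp a z w * Dww a z w - 2 * Az a w * Bw a z * Dz a z w
       - 2 * Az a w * (Dw a z w)^2 + Dp a z w * Dw a z w * Dzz a z w = 0 \<and>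
     3 * Bw a z * Dp a z w * Dzz a z w - 2 * Az a w * Bw a z * Dw a z w
       - 2 * Bw a z * (Dz a z w)^2 + Dp a z w * Dz a z w * Dww a z w = 0 \<and>
     2 * (Dp a z w)^2 * Dzz a z w * Dww a z w - Bw a z * Dp a z w * Dz a z w * Dzz a z w
       - Az a w * Dp a z w * Dw a z w * Dww a z w - Az a w * Bw a z * Dz a z w * Dw a z w
       + (Az a w)^2 * (Bw a z)^2 = 0)"

definition in_V :: "coeffs \<Rightarrow> bool" where
  "in_V a \<longleftrightarrow> nonzero_pt a \<and> pluecker a \<and> superint_conds a"

definition conj_pt :: "coeffs \<Rightarrow> coeffs" where
  "conj_pt a = (\<lambda>i j. a j i)"

definition class_111 :: "coeffs \<Rightarrow> bool" where
  "class_111 a \<longleftrightarrow>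
    (\<exists>a1 c1 a2 b2 c2 b3 c3 :: complex.
       a1 * b2 * c3 - a1 * c2 * b3 + c1 * a2 * b3 = 0 \<and> a1 \<noteq> 0 \<and> b3 \<noteq> 0 \<and>
       (\<forall>z w. Dp a z w = (a1 * z + c1) * (a2 * z + b2 * w + c2) * (b3 * w + c3)) \<and>
       (\<forall>w. Az a w = a1 * a2 * (b3 * w + c3)^2 / b3) \<and>
       (\<forall>z. Bw a z = b2 * b3 * (a1 * z + c1)^2 / a1))
  \<or> (\<exists>a2 b2 c2 :: complex.
       a2 \<noteq> 0 \<and> b2 \<noteq> 0 \<and>
       (\<forall>z w. Dp a z w = a2 * z + b2 * w + c2) \<and>
       (\<forall>w. Az a w = - (a2^2) / b2) \<and>
       (\<forall>z. Bw a z = - (b2^2) / a2))"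

definition class_11_0_1 :: "coeffs \<Rightarrow> bool" where
  "class_11_0_1 a \<longleftrightarrow>
    (\<exists>a1 c1 a2 c2 b3 c3 :: complex.
       b3 \<noteq> 0 \<and>
       (\<forall>z w. Dp a z w = (a1 * z + c1) * (a2 * z + c2) * (b3 * w + c3)) \<and>
       (\<forall>w. Az a w = a1 * a2 * (b3 * w + c3)^2 / b3) \<and>
       (\<forall>z. Bw a z = 0))"

definition class_11_0_0 :: "coeffs \<Rightarrow> bool" where
  "class_11_0_0 a \<longleftrightarrow>
    (\<exists>a1 c1 a2 c2 t :: complex.
       (\<forall>z w. Dp a z w = (a1 * z + c1) * (a2 * z + c2)) \<and>
       (\<forall>w. Az a w = 2 * a1 * a2 * w + t) \<and>
       (\<forall>z. Bw a z = 0))"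

definition class_0_11_0 :: "coeffs \<Rightarrow> bool" where
  "class_0_11_0 a \<longleftrightarrow>
    (\<exists>a1 b1 c1 a3 b3 c3 :: complex.
       a1 * b3 + b1 * a3 = 0 \<and> a1 * a3 * b1 * b3 \<noteq> 0 \<and>
       (\<forall>z w. Dp a z w = (a1 * z + b1 * w + c1) * (a3 * z + b3 * w + c3)) \<and>
       (\<forall>w. Az a w = a1 * a3 * (2 * w + c3 / b3 + c1 / b1)) \<and>
       (\<forall>z. Bw a z = b1 * b3 * (2 * z + c3 / a3 + c1 / a1)))"

definition class_1_0_11 :: "coeffs \<Rightarrow> bool" where
  "class_1_0_11 a \<longleftrightarrow> class_11_0_1 (conj_pt a)"

definition class_0_0_11 :: "coeffs \<Rightarrow> bool" where
  "class_0_0_11 a \<longleftrightarrow> class_11_0_0 (conj_pt a)"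

end

theory Submission
  imports Defs
begin

text \<open>
  The conditions are invariant under translations of \<open>z\<close> and \<open>w\<close> and under conjugation.
  If \<open>B\<^sub>w = 0\<close>, then \<open>D\<close> is linear in \<open>w\<close> and the Pluecker relations make its two
  coefficients proportional, which gives classes (2) and (3); \<open>A\<^sub>z = 0\<close> is the conjugate case.
  If neither vanishes, translate so that the subleading coefficients of \<open>A\<^sub>z\<close> and \<open>B\<^sub>w\<close>
  are zero. The Pluecker relations then leave very few coefficients, and comparing
  coefficients in the superintegrability conditions either is contradictory or leaves
  \<open>z w (p z + q w)\<close>, \<open>p z\<^sup>2 + q w\<^sup>2\<close> or a linear \<open>D\<close>.
\<close>

text \<open>Keeps the index \<open>1\<close> in terms such as \<open>a 1 0\<close> from turning into
  \<open>Suc 0\<close>, so that facts about coefficients continue to match.\<close>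

declare One_nat_def [simp del]

section \<open>Comparison of coefficients\<close>

text \<open>Evaluation at the five nodes 0, 1, -1, 2, -2 separates even and odd parts. Degree four
  covers the restrictions to lines used below.\<close>

lemma quartic_coeffs_eq_0:
  fixes c0 c1 c2 c3 c4 :: complex
  assumes "\<And>x. c0 + c1 * x + c2 * x^2 + c3 * x^3 + c4 * x^4 = 0"
  shows "c0 = 0 \<and> c1 = 0 \<and> c2 = 0 \<and> c3 = 0 \<and> c4 = 0"
proof -
  have e0: "c0 = 0" using assms[of 0] by simp
  have e1: "c1 + c2 + c3 + c4 = 0" using assms[of 1] e0 by simp
  have e2: "- c1 + c2 - c3 + c4 = 0" using assms[of "-1"] e0 by simp
  have e3: "2 * c1 + 4 * c2 + 8 * c3 + 16 * c4 = 0" using assms[of 2] e0 by (simp add: algebra_simps)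
  have e4: "- 2 * c1 + 4 * c2 - 8 * c3 + 16 * c4 = 0" using assms[of "-2"] e0 by (simp add: algebra_simps)
  have "24 * c4 = 0" using e1 e2 e3 e4 by algebra
  hence c4: "c4 = 0" by simp
  have "2 * c2 = 0" using e1 e2 c4 by algebra
  hence c2: "c2 = 0" by simp
  have "6 * c3 = 0" using e1 e3 c2 c4 by algebra
  hence c3: "c3 = 0" by simp
  show ?thesis using e0 e1 c2 c3 c4 by simp
qed

lemma quadratic_coeffs_eq:
  fixes c0 c1 c2 d0 d1 d2 :: complex
  assumes "\<And>x. c0 + c1 * x + c2 * x^2 = d0 + d1 * x + d2 * x^2"
  shows "c0 = d0 \<and> c1 = d1 \<and> c2 = d2"
  using quartic_coeffs_eq_0[of "c0 - d0" "c1 - d1" "c2 - d2" 0 0] assms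
  by (simp add: algebra_simps)

lemma Dp_coeffs:
  assumes "\<And>z w. Dp a z w = c00 + c10 * z + c01 * w + c20 * z^2 + c11 * z * w + c02 * w^2
              + c21 * z^2 * w + c12 * z * w^2"
  shows "a 0 0 = c00 \<and> a 1 0 = c10 \<and> a 0 1 = c01 \<and> a 2 0 = c20 \<and> a 1 1 = c11 \<and> a 0 2 = c02
     \<and> a 2 1 = c21 \<and> a 1 2 = c12"
proof -
  \<comment> \<open>For fixed \<open>z\<close> both sides are quadratics in \<open>w\<close> whose
    coefficients are quadratics in \<open>z\<close>, so comparison is done twice.\<close>
  have "a 0 0 + a 1 0 * z + a 2 0 * z^2 = c00 + c10 * z + c20 * z^2 \<and>
        a 0 1 + a 1 1 * z + a 2 1 * z^2 = c01 + c11 * z + c21 * z^2 \<and>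
        a 0 2 + a 1 2 * z + 0 * z^2 = c02 + c12 * z + 0 * z^2" for z
    by (rule quadratic_coeffs_eq) (use assms[of z] in \<open>simp add: Dp_def algebra_simps\<close>)
  then show ?thesis
    using quadratic_coeffs_eq[of "a 0 0" "a 1 0" "a 2 0" c00 c10 c20]
      quadratic_coeffs_eq[of "a 0 1" "a 1 1" "a 2 1" c01 c11 c21]
      quadratic_coeffs_eq[of "a 0 2" "a 1 2" 0 c02 c12 0] by blast
qed

lemma Az_coeffs:
  assumes "\<And>w. Az a w = c0 + 2 * c1 * w + c2 * w^2"
  shows "a 3 0 = c0 \<and> a 2 0 = c1 \<and> a 2 1 = c2"
  using quadratic_coeffs_eq[of "a 3 0" "2 * a 2 0" "a 2 1" c0 "2 * c1" c2] assms
  by (simp add: Az_def algebra_simps)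

lemma Bw_coeffs:
  assumes "\<And>z. Bw a z = c0 + 2 * c1 * z + c2 * z^2"
  shows "a 0 3 = c0 \<and> a 0 2 = c1 \<and> a 1 2 = c2"
  using quadratic_coeffs_eq[of "a 0 3" "2 * a 0 2" "a 1 2" c0 "2 * c1" c2] assms
  by (simp add: Bw_def algebra_simps)

text \<open>The quadratic formula; if the leading coefficient vanishes, the constant 1 serves as one
  of the factors.\<close>

lemma quadratic_factors:
  fixes p q r :: complex
  shows "\<exists>a1 c1 a2 c2. \<forall>z. r + q * z + p * z^2 = (a1 * z + c1) * (a2 * z + c2)"
proof (cases "p = 0")
  case True
  show ?thesis
    by (rule exI[of _ 0], rule exI[of _ 1], rule exI[of _ q], rule exI[of _ r]) (simp add: True)
next
  case False
  define d where "d = csqrt (q^2 - 4 * p * r)"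
  have d: "d^2 = q^2 - 4 * p * r" by (simp add: d_def)
  have "r + q * z + p * z^2 = (p * z + (q - d) / 2) * (1 * z + (q + d) / (2 * p))" for z
  proof -
    have "(p * z + (q - d) / 2) * (1 * z + (q + d) / (2 * p))
        = p * z^2 + q * z + (q^2 - d^2) / (4 * p)"
      using False by (simp add: field_simps power2_eq_square)
    also have "\<dots> = r + q * z + p * z^2" using False unfolding d by simp
    finally show ?thesis by simp
  qed
  then show ?thesis by blast
qed

section \<open>Symmetries\<close>

lemma conj_pt_simps [simp]:
  "Dp (conj_pt a) z w = Dp a w z" "Dz (conj_pt a) z w = Dw a w z" "Dw (conj_pt a) z w = Dz a w z"
  "Dzz (conj_pt a) z w = Dww a w z" "Dww (conj_pt a) z w = Dzz a w z"
  "Az (conj_pt a) w = Bw a w" "Bw (conj_pt a) z = Az a z" "conj_pt (conj_pt a) = a"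
  "conj_pt a i j = a j i"
  by (simp_all add: conj_pt_def Dp_def Dz_def Dw_def Dzz_def Dww_def Az_def Bw_def algebra_simps)

lemma pluecker_conj: "pluecker (conj_pt a) \<longleftrightarrow> pluecker a"
  unfolding pluecker_def conj_pt_def by (auto simp: algebra_simps)

text \<open>Exchanging the variables swaps the first two conditions and preserves the third.\<close>

lemma superint_conds_conj:
  assumes "superint_conds a" shows "superint_conds (conj_pt a)"
  unfolding superint_conds_def conj_pt_simps
proof (intro allI)
  fix z w
  show "3 * Bw a w * Dp a w z * Dzz a w z - 2 * Bw a w * Az a z * Dw a w z
       - 2 * Bw a w * (Dz a w z)^2 + Dp a w z * Dz a w z * Dww a w z = 0 \<and>
     3 * Az a z * Dp a w z * Dww a w z - 2 * Bw a w * Az a z * Dz a w z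
       - 2 * Az a z * (Dw a w z)^2 + Dp a w z * Dw a w z * Dzz a w z = 0 \<and>
     2 * (Dp a w z)^2 * Dww a w z * Dzz a w z - Az a z * Dp a w z * Dw a w z * Dww a w z
       - Bw a w * Dp a w z * Dz a w z * Dzz a w z - Bw a w * Az a z * Dw a w z * Dz a w z
       + (Bw a w)^2 * (Az a z)^2 = 0"
    using assms[unfolded superint_conds_def, rule_format, of z w]
    by (simp add: algebra_simps)
qed

text \<open>The Taylor coefficients after moving the origin to \<open>(s, r)\<close>. The entries
  shared by the three polynomials stay consistent because \<open>Dzz\<close> is the derivative of
  \<open>Az\<close> and \<open>Dww\<close> that of \<open>Bw\<close>.\<close>

definition shift_pt :: "complex \<Rightarrow> complex \<Rightarrow> coeffs \<Rightarrow> coeffs" where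
  "shift_pt s r a = (\<lambda>i j.
     if (i, j) = (0, 0) then Dp a s r
     else if (i, j) = (1, 0) then Dz a s r
     else if (i, j) = (0, 1) then Dw a s r
     else if (i, j) = (2, 0) then a 2 0 + a 2 1 * r
     else if (i, j) = (0, 2) then a 0 2 + a 1 2 * s
     else if (i, j) = (1, 1) then a 1 1 + 2 * a 2 1 * s + 2 * a 1 2 * r
     else if (i, j) = (3, 0) then Az a r
     else if (i, j) = (0, 3) then Bw a s
     else a i j)"

lemma shift_pt_coeffs:
  "shift_pt s r a 0 0 = Dp a s r" "shift_pt s r a 1 0 = Dz a s r" "shift_pt s r a 0 1 = Dw a s r"
  "shift_pt s r a 2 0 = a 2 0 + a 2 1 * r" "shift_pt s r a 0 2 = a 0 2 + a 1 2 * s"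
  "shift_pt s r a 1 1 = a 1 1 + 2 * a 2 1 * s + 2 * a 1 2 * r"
  "shift_pt s r a 2 1 = a 2 1" "shift_pt s r a 1 2 = a 1 2"
  "shift_pt s r a 3 0 = Az a r" "shift_pt s r a 0 3 = Bw a s"
  by (simp_all add: shift_pt_def)

lemma shift_pt_polys:
  "Dp (shift_pt s r a) z w = Dp a (z + s) (w + r)"
  "Dz (shift_pt s r a) z w = Dz a (z + s) (w + r)"
  "Dw (shift_pt s r a) z w = Dw a (z + s) (w + r)"
  "Dzz (shift_pt s r a) z w = Dzz a (z + s) (w + r)"
  "Dww (shift_pt s r a) z w = Dww a (z + s) (w + r)"
  "Az (shift_pt s r a) w = Az a (w + r)" "Bw (shift_pt s r a) z = Bw a (z + s)"
  unfolding Dp_def[of "shift_pt s r a"] Dz_def[of "shift_pt s r a"] Dw_def[of "shift_pt s r a"]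
    Dzz_def[of "shift_pt s r a"] Dww_def[of "shift_pt s r a"] Az_def[of "shift_pt s r a"]
    Bw_def[of "shift_pt s r a"] shift_pt_coeffs
  unfolding Dp_def Dz_def Dw_def Dzz_def Dww_def Az_def Bw_def
  by algebra+

lemma superint_conds_shift:
  assumes "superint_conds a" shows "superint_conds (shift_pt s r a)"
  using assms unfolding superint_conds_def shift_pt_polys by blast

lemma pluecker_shift:
  assumes "pluecker a" shows "pluecker (shift_pt s r a)"
  using assms unfolding pluecker_def shift_pt_coeffs Dp_def Dz_def Dw_def Az_def Bw_def
  by (elim conjE, intro conjI) algebra+

text \<open>In the first branch the relation is the vanishing of the determinant of the three linear
  factors, which is translation invariant; the constant terms absorb the shift.\<close>

lemma class_111_shiftD:
  assumes "class_111 (shift_pt s r a)" shows "class_111 a"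
  using assms[unfolded class_111_def]
proof (elim disjE exE conjE)
  fix a1 c1 a2 b2 c2 b3 c3
  assume rel: "a1 * b2 * c3 - a1 * c2 * b3 + c1 * a2 * b3 = 0" and nz: "a1 \<noteq> 0" "b3 \<noteq> 0"
    and D: "\<forall>z w. Dp (shift_pt s r a) z w = (a1 * z + c1) * (a2 * z + b2 * w + c2) * (b3 * w + c3)"
    and A: "\<forall>w. Az (shift_pt s r a) w = a1 * a2 * (b3 * w + c3)^2 / b3"
    and B: "\<forall>z. Bw (shift_pt s r a) z = b2 * b3 * (a1 * z + c1)^2 / a1"
  have "a1 * b2 * (c3 - b3 * r) - a1 * (c2 - a2 * s - b2 * r) * b3 + (c1 - a1 * s) * a2 * b3 = 0"
    using rel by algebra
  moreover have "Dp a z w = (a1 * z + (c1 - a1 * s)) * (a2 * z + b2 * w + (c2 - a2 * s - b2 * r))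
      * (b3 * w + (c3 - b3 * r))" for z w
    using D[rule_format, of "z - s" "w - r"] by (simp add: shift_pt_polys algebra_simps)
  moreover have "Az a w = a1 * a2 * (b3 * w + (c3 - b3 * r))^2 / b3" for w
    using A[rule_format, of "w - r"]
    by (simp add: shift_pt_polys right_diff_distrib add_diff_eq diff_add_eq)
  moreover have "Bw a z = b2 * b3 * (a1 * z + (c1 - a1 * s))^2 / a1" for z
    using B[rule_format, of "z - s"]
    by (simp add: shift_pt_polys right_diff_distrib add_diff_eq diff_add_eq)
  ultimately show ?thesis unfolding class_111_def using nz by blast
next
  fix a2 b2 c2
  assume nz: "a2 \<noteq> 0" "b2 \<noteq> 0"
    and D: "\<forall>z w. Dp (shift_pt s r a) z w = a2 * z + b2 * w + c2"
    and A: "\<forall>w. Az (shift_pt s r a) w = - (a2^2) / b2"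
    and B: "\<forall>z. Bw (shift_pt s r a) z = - (b2^2) / a2"
  have "Dp a z w = a2 * z + b2 * w + (c2 - a2 * s - b2 * r)" for z w
    using D[rule_format, of "z - s" "w - r"] by (simp add: shift_pt_polys algebra_simps)
  moreover have "Az a w = - (a2^2) / b2" for w
    using A[rule_format, of "w - r"] by (simp add: shift_pt_polys)
  moreover have "Bw a z = - (b2^2) / a2" for z
    using B[rule_format, of "z - s"] by (simp add: shift_pt_polys)
  ultimately show ?thesis unfolding class_111_def using nz by blast
qed

lemma class_0_11_0_shiftD:
  assumes "class_0_11_0 (shift_pt s r a)" shows "class_0_11_0 a"
proof -
  obtain a1 b1 c1 a3 b3 c3 where rel: "a1 * b3 + b1 * a3 = 0" and nz: "a1 * a3 * b1 * b3 \<noteq> 0"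
    and D: "\<And>z w. Dp (shift_pt s r a) z w = (a1 * z + b1 * w + c1) * (a3 * z + b3 * w + c3)"
    and A: "\<And>w. Az (shift_pt s r a) w = a1 * a3 * (2 * w + c3 / b3 + c1 / b1)"
    and B: "\<And>z. Bw (shift_pt s r a) z = b1 * b3 * (2 * z + c3 / a3 + c1 / a1)"
    using assms unfolding class_0_11_0_def by blast
  define d1 d3 where d: "d1 = c1 - a1 * s - b1 * r" "d3 = c3 - a3 * s - b3 * r"
  have nz': "a1 \<noteq> 0" "a3 \<noteq> 0" "b1 \<noteq> 0" "b3 \<noteq> 0" using nz by auto
  \<comment> \<open>These two sums make the root of \<open>Az\<close> independent of
    \<open>s\<close> and that of \<open>Bw\<close> independent of \<open>r\<close>.\<close>
  have ab: "a3 / b3 + a1 / b1 = 0" using rel nz' by (simp add: field_simps)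
  have ba: "b3 / a3 + b1 / a1 = 0" using rel nz' by (simp add: field_simps)
  have "Dp a z w = (a1 * z + b1 * w + d1) * (a3 * z + b3 * w + d3)" for z w
    using D[of "z - s" "w - r"] by (simp add: shift_pt_polys d algebra_simps)
  moreover have "Az a w = a1 * a3 * (2 * w + d3 / b3 + d1 / b1)" for w
  proof -
    have "d3 / b3 + d1 / b1 = c3 / b3 + c1 / b1 - 2 * r - s * (a3 / b3 + a1 / b1)"
      using nz' by (simp add: d field_simps)
    then have "2 * (w - r) + c3 / b3 + c1 / b1 = 2 * w + d3 / b3 + d1 / b1"
      unfolding ab by (simp add: algebra_simps)
    then show ?thesis using A[of "w - r"] by (simp add: shift_pt_polys)
  qed
  moreover have "Bw a z = b1 * b3 * (2 * z + d3 / a3 + d1 / a1)" for z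
  proof -
    have "d3 / a3 + d1 / a1 = c3 / a3 + c1 / a1 - 2 * s - r * (b3 / a3 + b1 / a1)"
      using nz' by (simp add: d field_simps)
    then have "2 * (z - s) + c3 / a3 + c1 / a1 = 2 * z + d3 / a3 + d1 / a1"
      unfolding ba by (simp add: algebra_simps)
    then show ?thesis using B[of "z - s"] by (simp add: shift_pt_polys)
  qed
  ultimately show ?thesis unfolding class_0_11_0_def using rel nz by blast
qed

section \<open>Points of the variety lie in the classes\<close>

lemma superint_condsD:
  assumes "superint_conds a"
  shows "3 * Az a w * Dp a z w * Dww a z w - 2 * Az a w * Bw a z * Dz a z w
       - 2 * Az a w * (Dw a z w)^2 + Dp a z w * Dw a z w * Dzz a z w = 0"
    and "3 * Bw a z * Dp a z w * Dzz a z w - 2 * Az a w * Bw a z * Dw a z w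
       - 2 * Bw a z * (Dz a z w)^2 + Dp a z w * Dz a z w * Dww a z w = 0"
    and "2 * (Dp a z w)^2 * Dzz a z w * Dww a z w - Bw a z * Dp a z w * Dz a z w * Dzz a z w
       - Az a w * Dp a z w * Dw a z w * Dww a z w - Az a w * Bw a z * Dz a z w * Dw a z w
       + (Az a w)^2 * (Bw a z)^2 = 0"
  using assms unfolding superint_conds_def by blast+

lemmas polys = Dp_def Dz_def Dw_def Dzz_def Dww_def Az_def Bw_def

text \<open>Just enough arithmetic to insert zeros and ones, leaving products unexpanded for
  \<open>algebra\<close>.\<close>

lemmas zero_one = power_zero_numeral power_one mult_zero_left mult_zero_right mult_1_left
  mult_1_right add_0_left add_0_right diff_0_right

lemma class_if_Bw_eq_0:
  assumes pl: "pluecker a" and si: "superint_conds a"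
    and B: "a 1 2 = 0" "a 0 2 = 0" "a 0 3 = 0"
  shows "class_11_0_1 a \<or> class_11_0_0 a"
proof (cases "a 0 1 = 0 \<and> a 1 1 = 0 \<and> a 2 1 = 0")
  case True
  obtain a1 c1 a2 c2 where f: "\<And>z. a 0 0 + a 1 0 * z + a 2 0 * z^2 = (a1 * z + c1) * (a2 * z + c2)"
    using quadratic_factors by blast
  have co: "a 0 0 = c1 * c2 \<and> a 1 0 = a1 * c2 + c1 * a2 \<and> a 2 0 = a1 * a2"
    by (rule quadratic_coeffs_eq) (unfold f, algebra)
  have "class_11_0_0 a" unfolding class_11_0_0_def
    by (rule exI[of _ a1], rule exI[of _ c1], rule exI[of _ a2], rule exI[of _ c2], rule exI[of _ "a 3 0"])
      (use True B f co in \<open>auto simp: Dp_def Az_def Bw_def\<close>)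
  then show ?thesis ..
next
  case False
  \<comment> \<open>The 2x2 minors of the coefficient vectors of \<open>w^0\<close> and
    \<open>w^1\<close> in \<open>D\<close>; they yield \<open>D = Q z * (w + l)\<close>.\<close>
  have minors: "a 0 1 * a 1 0 = a 0 0 * a 1 1" "a 0 1 * a 2 0 = a 0 0 * a 2 1"
      "a 1 1 * a 2 0 = a 1 0 * a 2 1"
    using pl B by (simp_all add: pluecker_def algebra_simps)
  obtain l where l: "a 0 0 = l * a 0 1" "a 1 0 = l * a 1 1" "a 2 0 = l * a 2 1"
  proof -
    consider "a 0 1 \<noteq> 0" | "a 1 1 \<noteq> 0" | "a 2 1 \<noteq> 0" using False by blast
    then show ?thesis
    proof cases
      case 1 with minors show ?thesis
        by (intro that[of "a 0 0 / a 0 1"]) (simp_all add: field_simps)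
    next
      case 2 with minors show ?thesis
        by (intro that[of "a 1 0 / a 1 1"]) (simp_all add: field_simps)
    next
      case 3 with minors show ?thesis
        by (intro that[of "a 2 0 / a 2 1"]) (simp_all add: field_simps)
    qed
  qed
  define Q where "Q z = a 0 1 + a 1 1 * z + a 2 1 * z^2" for z
  obtain z0 where z0: "Q z0 \<noteq> 0"
    using False quadratic_coeffs_eq[of "a 0 1" "a 1 1" "a 2 1" 0 0 0] unfolding Q_def by auto
  have D: "Dp a z w = Q z * (w + l)" for z w
    by (simp add: Dp_def Q_def B l algebra_simps)
  have "Dw a z0 0 = Q z0" by (simp add: Dw_def Q_def B)
  \<comment> \<open>Only the terms without \<open>Bw\<close> and \<open>Dww\<close> survive; taking
    \<open>w = 0\<close> off the zeros of \<open>Q\<close> isolates \<open>a 3 0\<close>.\<close>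
  with superint_condsD(1)[OF si, of 0 z0] have "2 * (Q z0)^2 * (l * a 2 0 - a 3 0) = 0"
    by (simp add: Dww_def Dzz_def Bw_def B Az_def D power2_eq_square algebra_simps)
  with z0 have a30: "a 3 0 = l * a 2 0" by simp
  obtain a1 c1 a2 c2 where f: "\<And>z. Q z = (a1 * z + c1) * (a2 * z + c2)"
    using quadratic_factors unfolding Q_def by blast
  have "a 0 1 = c1 * c2 \<and> a 1 1 = a1 * c2 + c1 * a2 \<and> a 2 1 = a1 * a2"
    by (rule quadratic_coeffs_eq) (unfold f[unfolded Q_def], algebra)
  then have a21: "a 2 1 = a1 * a2" by blast
  have "class_11_0_1 a" unfolding class_11_0_1_def
    by (rule exI[of _ a1], rule exI[of _ c1], rule exI[of _ a2], rule exI[of _ c2], rule exI[of _ 1], rule exI[of _ l])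
      (simp add: D f Az_def Bw_def B a30 l a21 power2_eq_square algebra_simps)
  then show ?thesis ..
qed

lemma class_111_if_both_quadratic:
  assumes pl0: "pluecker a" and si0: "superint_conds a" and nz: "a 2 1 \<noteq> 0" "a 1 2 \<noteq> 0"
  shows "class_111 a"
proof -
  \<comment> \<open>The new origin is where \<open>Dww\<close> and \<open>Dzz\<close> vanish, which
    removes \<open>b 0 2\<close> and \<open>b 2 0\<close>.\<close>
  define b where "b = shift_pt (- a 0 2 / a 1 2) (- a 2 0 / a 2 1) a"
  define p q c where pqc: "p = b 2 1" "q = b 1 2" "c = b 1 1"
  have pl: "pluecker b" and si: "superint_conds b"
    unfolding b_def using pl0 si0 by (simp_all add: pluecker_shift superint_conds_shift)
  have nz': "p \<noteq> 0" "q \<noteq> 0" using nz by (simp_all add: pqc b_def shift_pt_coeffs)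
  have z: "b 2 0 = 0" "b 0 2 = 0" using nz by (simp_all add: b_def shift_pt_coeffs)
  define \<alpha> \<beta> where ab: "\<alpha> = b 3 0 / p" "\<beta> = b 0 3 / q"
  have b30: "b 3 0 = p * \<alpha>" and b03: "b 0 3 = q * \<beta>" using nz' by (simp_all add: ab)
  have b00: "b 0 0 = 0" using pl nz' z by (simp add: pluecker_def pqc)
  have "q * (p * \<beta> + b 0 1) = 0" "p * (q * \<alpha> + b 1 0) = 0"
    using pl z b30 b03 by (simp_all add: pluecker_def pqc algebra_simps)
  then have b01: "b 0 1 = - p * \<beta>" and b10: "b 1 0 = - q * \<alpha>"
    using nz' by (simp_all add: add_eq_0_iff)
  note co = b30 b03 b00 b01 b10 z pqc[symmetric]
  \<comment> \<open>On the line \<open>z = 0\<close> the first condition has leading coefficient \<open>- 2 p q\<^sup>2 \<beta>\<close>;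
    symmetrically for the second one on \<open>w = 0\<close>.\<close>
  have \<beta>: "\<beta> = 0"
  proof -
    have "(2 * p * q^2 * \<beta> * \<alpha>^2 - 2 * p^3 * \<beta>^2 * \<alpha>) + (- 2 * p * q * \<beta> * \<alpha> * c) * w + 0 * w^2
        + (- 2 * p * q * \<beta> * c) * w^3 + (- 2 * p * q^2 * \<beta>) * w^4 = 0" for w
      using superint_condsD(1)[OF si, of w 0] by (simp only: polys co zero_one) algebra
    from quartic_coeffs_eq_0[OF this] nz' show ?thesis by simp
  qed
  have \<alpha>: "\<alpha> = 0"
  proof -
    have "(2 * q * p^2 * \<alpha> * \<beta>^2 - 2 * q^3 * \<alpha>^2 * \<beta>) + (- 2 * q * p * \<alpha> * \<beta> * c) * w + 0 * w^2
        + (- 2 * q * p * \<alpha> * c) * w^3 + (- 2 * q * p^2 * \<alpha>) * w^4 = 0" for w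
      using superint_condsD(2)[OF si, of w 0] by (simp only: polys co zero_one) algebra
    from quartic_coeffs_eq_0[OF this] nz' show ?thesis by simp
  qed
  \<comment> \<open>The only remaining unwanted term of \<open>D\<close> is
    \<open>c * z * w\<close>; a single evaluation excludes it, leaving
    \<open>z * (p * z + q * w) * w\<close>.\<close>
  have "2 * p * q * c = 0"
    using superint_condsD(1)[OF si, of 1 1] by (simp only: polys co \<alpha> \<beta> zero_one) algebra
  then have c: "c = 0" using nz' by simp
  have "class_111 b" unfolding class_111_def
    by (rule disjI1, rule exI[of _ 1], rule exI[of _ 0], rule exI[of _ p], rule exI[of _ q],
      rule exI[of _ 0], rule exI[of _ 1], rule exI[of _ 0],
        simp add: polys co \<alpha> \<beta> c power2_eq_square algebra_simps)
  then show ?thesis unfolding b_def by (rule class_111_shiftD)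
qed

text \<open>If \<open>Bw\<close> were nonzero, the first Pluecker relation would make it linear. In
  centred coordinates the first condition on \<open>z = 0\<close> then has leading coefficient
  \<open>2 * p * q^2\<close>, which is nonzero.\<close>

lemma Bw_eq_0_if_Az_quadratic:
  assumes pl0: "pluecker a" and si0: "superint_conds a" and nz: "a 2 1 \<noteq> 0" "a 1 2 = 0"
  shows "a 0 2 = 0 \<and> a 0 3 = 0"
proof (rule ccontr)
  assume neg: "\<not> ?thesis"
  have "a 0 2 \<noteq> 0"
    using neg pl0 nz by (auto simp: pluecker_def)
  define b where "b = shift_pt (- a 0 3 / (2 * a 0 2)) (- a 2 0 / a 2 1) a"
  define p q c where pqc: "p = b 2 1" "q = b 0 2" "c = b 0 1"
  have pl: "pluecker b" and si: "superint_conds b"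
    unfolding b_def using pl0 si0 by (simp_all add: pluecker_shift superint_conds_shift)
  have nz': "p \<noteq> 0" "q \<noteq> 0" using nz \<open>a 0 2 \<noteq> 0\<close> by (simp_all add: pqc b_def shift_pt_coeffs)
  have z: "b 2 0 = 0" "b 0 3 = 0" "b 1 2 = 0"
    using nz \<open>a 0 2 \<noteq> 0\<close> by (simp_all add: b_def shift_pt_coeffs Bw_def)
  define \<alpha> where "\<alpha> = b 3 0 / p"
  have b30: "b 3 0 = p * \<alpha>" using nz' by (simp add: \<alpha>_def)
  have b10: "b 1 0 = 0" and b11: "b 1 1 = 0"
    using pl z nz' by (simp_all add: pluecker_def pqc)
  have "p * (q * \<alpha> + b 0 0) = 0"
    using pl z b30 by (simp add: pluecker_def pqc algebra_simps)
  then have b00: "b 0 0 = - q * \<alpha>" using nz' by (simp add: add_eq_0_iff)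
  note co = b30 b00 b11 b10 z pqc[symmetric]
  have "(- 6 * p * q^2 * \<alpha>^2 - 2 * p * \<alpha> * c^2) + (- 4 * p * q * \<alpha> * c) * w
      + (- 12 * p * q^2 * \<alpha>) * w^2 + (4 * p * q * c) * w^3 + (2 * p * q^2) * w^4 = 0" for w
    using superint_condsD(1)[OF si, of w 0] by (simp only: polys co zero_one) algebra
  then have "2 * p * q^2 = 0" using quartic_coeffs_eq_0 by blast
  with nz' show False by simp
qed

lemma class_0_11_0_if_both_linear:
  assumes pl0: "pluecker a" and si0: "superint_conds a"
    and q0: "a 2 1 = 0" "a 1 2 = 0" and nz: "a 2 0 \<noteq> 0" "a 0 2 \<noteq> 0"
  shows "class_0_11_0 a"
proof -
  \<comment> \<open>The origin moves to the roots of \<open>Bw\<close> and \<open>Az\<close>; the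
    Pluecker relations then leave \<open>D = p * z^2 + q * w^2 + c\<close>.\<close>
  define b where "b = shift_pt (- a 0 3 / (2 * a 0 2)) (- a 3 0 / (2 * a 2 0)) a"
  define p q c where pqc: "p = b 2 0" "q = b 0 2" "c = b 0 0"
  have pl: "pluecker b" and si: "superint_conds b"
    unfolding b_def using pl0 si0 by (simp_all add: pluecker_shift superint_conds_shift)
  have nz': "p \<noteq> 0" "q \<noteq> 0" using nz q0 by (simp_all add: pqc b_def shift_pt_coeffs)
  have z: "b 2 1 = 0" "b 1 2 = 0" "b 0 3 = 0" "b 3 0 = 0"
    using nz q0 by (simp_all add: b_def shift_pt_coeffs Bw_def Az_def)
  have z': "b 1 0 = 0" "b 0 1 = 0" "b 1 1 = 0"
    using pl z nz' by (simp_all add: pluecker_def pqc)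
  note co = z z' pqc[symmetric]
  have "16 * p * q * c = 0"
    using superint_condsD(1)[OF si, of 1 0] by (simp only: polys co zero_one) algebra
  then have c: "c = 0" using nz' by simp
  \<comment> \<open>Chosen so that
    \<open>p * z^2 + q * w^2 = (u * z + v * w) * (u * z - v * w)\<close>.\<close>
  define u v where uv: "u = csqrt p" "v = \<i> * csqrt q"
  have p: "p = u * u" and q: "q = - (v * v)"
    using power2_csqrt[of p] power2_csqrt[of q] by (simp_all add: uv power2_eq_square algebra_simps)
  have nzuv: "u \<noteq> 0" "v \<noteq> 0" using nz' p q by auto
  have "class_0_11_0 b" unfolding class_0_11_0_def
    by (rule exI[of _ u], rule exI[of _ v],
      rule exI[of _ 0], rule exI[of _ u], rule exI[of _ "- v"], rule exI[of _ 0],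
        simp add: nzuv polys co c p q power2_eq_square algebra_simps)
  then show ?thesis unfolding b_def by (rule class_0_11_0_shiftD)
qed

text \<open>Since \<open>Dzz\<close> and \<open>Dww\<close> vanish, the third condition says that
  \<open>Dz * Dw\<close> equals the nonzero constant \<open>Az * Bw\<close>, so \<open>D\<close> is
  linear; the first two conditions then determine \<open>Bw\<close> and \<open>Az\<close>.\<close>

lemma class_111_if_both_constant:
  assumes si: "superint_conds a"
    and z: "a 2 1 = 0" "a 1 2 = 0" "a 2 0 = 0" "a 0 2 = 0" and nz: "a 3 0 \<noteq> 0" "a 0 3 \<noteq> 0"
  shows "class_111 a"
proof -
  have "a 3 0 * a 0 3 * (a 3 0 * a 0 3 - (a 1 0 + a 1 1 * w) * (a 0 1 + a 1 1 * z)) = 0" for z w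
    using superint_condsD(3)[OF si, of z w] by (simp only: polys z zero_one) algebra
  then have e3: "(a 1 0 + a 1 1 * w) * (a 0 1 + a 1 1 * z) = a 3 0 * a 0 3" for z w
    using nz by simp
  \<comment> \<open>Otherwise the chosen argument is a zero of one factor, while the product is
    nonzero.\<close>
  have a11: "a 1 1 = 0"
    using e3[of 0 "- a 0 1 / a 1 1"] nz by (cases "a 1 1 = 0") auto
  have nz': "a 1 0 \<noteq> 0" "a 0 1 \<noteq> 0" using e3[of 0 0] nz by auto
  have "2 * a 3 0 * (a 0 3 * a 1 0 + (a 0 1)^2) = 0"
    using superint_condsD(1)[OF si, of 0 0] by (simp only: polys z zero_one) algebra
  then have "a 0 3 * a 1 0 = - ((a 0 1)^2)" using nz by (simp add: eq_neg_iff_add_eq_0)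
  then have a03: "a 0 3 = - ((a 0 1)^2) / a 1 0" using nz' by (simp add: field_simps)
  have "2 * a 0 3 * (a 3 0 * a 0 1 + (a 1 0)^2) = 0"
    using superint_condsD(2)[OF si, of 0 0] by (simp only: polys z zero_one) algebra
  then have "a 3 0 * a 0 1 = - ((a 1 0)^2)" using nz by (simp add: eq_neg_iff_add_eq_0)
  then have a30: "a 3 0 = - ((a 1 0)^2) / a 0 1" using nz' by (simp add: field_simps)
  show ?thesis unfolding class_111_def
    by (rule disjI2, rule exI[of _ "a 1 0"], rule exI[of _ "a 0 1"], rule exI[of _ "a 0 0"])
      (use nz' a03 a30 in \<open>simp add: Dp_def Az_def Bw_def z a11\<close>)
qed

text \<open>The cases are the degrees of \<open>Az\<close> and \<open>Bw\<close>. If these differ,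
  the polynomial of lower degree must be zero.\<close>

lemma class_if_in_V:
  assumes pl: "pluecker a" and si: "superint_conds a"
  shows "class_111 a \<or> class_11_0_1 a \<or> class_11_0_0 a \<or> class_0_11_0 a \<or>
     class_1_0_11 a \<or> class_0_0_11 a"
proof -
  have plc: "pluecker (conj_pt a)" and sic: "superint_conds (conj_pt a)"
    using pl si by (simp_all add: pluecker_conj superint_conds_conj)
  have B0: ?thesis if "a 1 2 = 0" "a 0 2 = 0" "a 0 3 = 0"
    using class_if_Bw_eq_0[OF pl si that] by blast
  have A0: ?thesis if "a 2 1 = 0" "a 2 0 = 0" "a 3 0 = 0"
    using class_if_Bw_eq_0[OF plc sic] that unfolding class_1_0_11_def class_0_0_11_def by simp
  consider "a 2 1 \<noteq> 0" "a 1 2 \<noteq> 0" | "a 2 1 \<noteq> 0" "a 1 2 = 0" | "a 2 1 = 0" "a 1 2 \<noteq> 0"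
    | "a 2 1 = 0" "a 1 2 = 0" by blast
  then show ?thesis
  proof cases
    case 1 then show ?thesis using class_111_if_both_quadratic[OF pl si] by blast
  next
    case 2 then show ?thesis using Bw_eq_0_if_Az_quadratic[OF pl si] B0 by blast
  next
    case 3 then show ?thesis using Bw_eq_0_if_Az_quadratic[OF plc sic] A0 by simp
  next
    case 4
    \<comment> \<open>If exactly one of \<open>Az\<close>, \<open>Bw\<close> is linear, one of these
      makes the other vanish.\<close>
    have m: "a 0 3 * a 2 0 = a 0 2 * a 1 0" "a 0 2 * a 3 0 = a 0 1 * a 2 0"
      using pl 4 by (simp_all add: pluecker_def)
    consider "a 2 0 \<noteq> 0" "a 0 2 \<noteq> 0" | "a 2 0 \<noteq> 0" "a 0 2 = 0" | "a 2 0 = 0" "a 0 2 \<noteq> 0"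
      | "a 2 0 = 0" "a 0 2 = 0" by blast
    then show ?thesis
    proof cases
      case 1 then show ?thesis using class_0_11_0_if_both_linear[OF pl si 4] by blast
    next
      case 2 then show ?thesis using m B0 4 by simp
    next
      case 3 then show ?thesis using m A0 4 by simp
    next
      case zero: 4
      then show ?thesis using class_111_if_both_constant[OF si 4] A0 B0 4 by blast
    qed
  qed
qed

section \<open>The classes lie in the variety\<close>

lemma in_V_if_class_111:
  assumes "class_111 a" shows "pluecker a \<and> superint_conds a"
  using assms unfolding class_111_def
proof (elim disjE exE conjE)
  fix a1 c1 a2 b2 c2 b3 c3
  assume rel: "a1 * b2 * c3 - a1 * c2 * b3 + c1 * a2 * b3 = 0" and nz: "a1 \<noteq> 0" "b3 \<noteq> 0"
    and D: "\<forall>z w. Dp a z w = (a1 * z + c1) * (a2 * z + b2 * w + c2) * (b3 * w + c3)"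
    and A: "\<forall>w. Az a w = a1 * a2 * (b3 * w + c3)^2 / b3"
    and B: "\<forall>z. Bw a z = b2 * b3 * (a1 * z + c1)^2 / a1"
  \<comment> \<open>The first and third lines meet at \<open>(- g, - h)\<close>; \<open>rel\<close>
    puts that point on the second factor too. Centring there gives
    \<open>D = Z * W * (p * Z + q * W)\<close>.\<close>
  define g h p q where gh: "g = c1 / a1" "h = c3 / b3" "p = a1 * a2 * b3" "q = a1 * b2 * b3"
  have c: "c1 = a1 * g" "c3 = b3 * h" using nz by (simp_all add: gh)
  have "a1 * b3 * c2 = a1 * b3 * (b2 * h + a2 * g)" using rel unfolding c by algebra
  then have c2: "c2 = b2 * h + a2 * g" using nz by simp
  have A': "Az a w = p * h^2 + 2 * (p * h) * w + p * w^2" for w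
    unfolding A[rule_format] c gh(3) using nz by (simp add: power2_eq_square field_simps)
  have B': "Bw a z = q * g^2 + 2 * (q * g) * z + q * z^2" for z
    unfolding B[rule_format] c gh(4) using nz by (simp add: power2_eq_square field_simps)
  have D': "Dp a z w = (p * g^2 * h + q * g * h^2) + (2 * p * g * h + q * h^2) * z
      + (p * g^2 + 2 * q * g * h) * w + (p * h) * z^2 + (2 * p * g + 2 * q * h) * z * w
      + (q * g) * w^2 + p * z^2 * w + q * z * w^2" for z w
    unfolding D[rule_format] c c2 gh(3,4) by algebra
  note co = Dp_coeffs[OF D'] Az_coeffs[OF A'] Bw_coeffs[OF B']
  have pl: "pluecker a" unfolding pluecker_def using co by algebra
  have "superint_conds a" unfolding superint_conds_def
  proof (intro allI)
    fix z w
    define Z W where ZW: "Z = z + g" "W = w + h"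
    have e: "Dp a z w = Z * W * (p * Z + q * W)" "Dz a z w = W * (2 * p * Z + q * W)"
      "Dw a z w = Z * (p * Z + 2 * q * W)" "Dzz a z w = 2 * p * W" "Dww a z w = 2 * q * Z"
      "Az a w = p * W^2" "Bw a z = q * Z^2"
      unfolding Dp_def Dz_def Dw_def Dzz_def Dww_def Az_def Bw_def ZW using co by algebra+
    show "3 * Az a w * Dp a z w * Dww a z w - 2 * Az a w * Bw a z * Dz a z w
       - 2 * Az a w * (Dw a z w)^2 + Dp a z w * Dw a z w * Dzz a z w = 0 \<and>
     3 * Bw a z * Dp a z w * Dzz a z w - 2 * Az a w * Bw a z * Dw a z w
       - 2 * Bw a z * (Dz a z w)^2 + Dp a z w * Dz a z w * Dww a z w = 0 \<and>
     2 * (Dp a z w)^2 * Dzz a z w * Dww a z w - Bw a z * Dp a z w * Dz a z w * Dzz a z w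
       - Az a w * Dp a z w * Dw a z w * Dww a z w - Az a w * Bw a z * Dz a z w * Dw a z w
       + (Az a w)^2 * (Bw a z)^2 = 0"
      unfolding e by (intro conjI) algebra+
  qed
  with pl show ?thesis ..
next
  fix a2 b2 c2
  assume nz: "a2 \<noteq> 0" "b2 \<noteq> 0"
    and D: "\<forall>z w. Dp a z w = a2 * z + b2 * w + c2"
    and A: "\<forall>w. Az a w = - (a2^2) / b2"
    and B: "\<forall>z. Bw a z = - (b2^2) / a2"
  have D': "Dp a z w = c2 + a2 * z + b2 * w + 0 * z^2 + 0 * z * w + 0 * w^2 + 0 * z^2 * w
      + 0 * z * w^2" for z w using D by simp
  have A': "Az a w = - (a2^2) / b2 + 2 * 0 * w + 0 * w^2" for w using A by simp
  have B': "Bw a z = - (b2^2) / a2 + 2 * 0 * z + 0 * z^2" for z using B by simp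
  note co = Dp_coeffs[OF D'] Az_coeffs[OF A'] Bw_coeffs[OF B']
  show ?thesis
    using nz by (simp add: pluecker_def superint_conds_def co Dp_def Dz_def Dw_def Dzz_def Dww_def
        Az_def Bw_def field_simps power2_eq_square)
qed

text \<open>Every term with a factor \<open>Bw\<close> or \<open>Dww\<close> drops out; the other
  two cancel because \<open>D = (w + h) * Dw\<close> and
  \<open>2 * Az = (w + h) * Dzz\<close>.\<close>

lemma in_V_if_class_11_0_1:
  assumes "class_11_0_1 a" shows "pluecker a \<and> superint_conds a"
proof -
  obtain a1 c1 a2 c2 b3 c3 where nz: "b3 \<noteq> 0"
    and D: "\<And>z w. Dp a z w = (a1 * z + c1) * (a2 * z + c2) * (b3 * w + c3)"
    and A: "\<And>w. Az a w = a1 * a2 * (b3 * w + c3)^2 / b3" and B: "\<And>z. Bw a z = 0"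
    using assms unfolding class_11_0_1_def by blast
  define h where "h = c3 / b3"
  have c: "c3 = b3 * h" using nz by (simp add: h_def)
  have A': "Az a w = a1 * a2 * b3 * h^2 + 2 * (a1 * a2 * b3 * h) * w + (a1 * a2 * b3) * w^2" for w
    unfolding A c using nz by (simp add: power2_eq_square field_simps)
  have B': "Bw a z = 0 + 2 * 0 * z + 0 * z^2" for z using B by simp
  have D': "Dp a z w = c1 * c2 * b3 * h + ((a1 * c2 + c1 * a2) * b3 * h) * z + (c1 * c2 * b3) * w
      + (a1 * a2 * b3 * h) * z^2 + ((a1 * c2 + c1 * a2) * b3) * z * w + 0 * w^2
      + (a1 * a2 * b3) * z^2 * w + 0 * z * w^2" for z w
    unfolding D c by algebra
  note co = Dp_coeffs[OF D'] Az_coeffs[OF A'] Bw_coeffs[OF B']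
  have pl: "pluecker a" unfolding pluecker_def using co by algebra
  have e: "Dww a z w = 0" "Bw a z = 0"
     "Az a w = a1 * a2 * b3 * (w + h)^2" "Dzz a z w = 2 * a1 * a2 * b3 * (w + h)"
     "Dp a z w = Dw a z w * (w + h)" for z w
    unfolding Dp_def Dw_def Dzz_def Dww_def Az_def Bw_def using co by algebra+
  have "superint_conds a" unfolding superint_conds_def e
    by (simp add: power2_eq_square)
  with pl show ?thesis ..
qed

text \<open>\<open>D\<close> is free of \<open>w\<close>, so each term of the three conditions
  contains a vanishing factor \<open>Dw\<close>, \<open>Dww\<close> or \<open>Bw\<close>.\<close>

lemma in_V_if_class_11_0_0:
  assumes "class_11_0_0 a" shows "pluecker a \<and> superint_conds a"
proof -
  obtain a1 c1 a2 c2 t where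
    D: "\<And>z w. Dp a z w = (a1 * z + c1) * (a2 * z + c2)"
    and A: "\<And>w. Az a w = 2 * a1 * a2 * w + t" and B: "\<And>z. Bw a z = 0"
    using assms unfolding class_11_0_0_def by blast
  have A': "Az a w = t + 2 * (a1 * a2) * w + 0 * w^2" for w
    using A by simp
  have B': "Bw a z = 0 + 2 * 0 * z + 0 * z^2" for z using B by simp
  have D': "Dp a z w = c1 * c2 + (a1 * c2 + c1 * a2) * z + 0 * w + (a1 * a2) * z^2
      + 0 * z * w + 0 * w^2 + 0 * z^2 * w + 0 * z * w^2" for z w
    unfolding D by algebra
  note co = Dp_coeffs[OF D'] Az_coeffs[OF A'] Bw_coeffs[OF B']
  show ?thesis
    by (simp add: pluecker_def superint_conds_def co Dw_def Dww_def Bw_def)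
qed

lemma in_V_if_class_0_11_0:
  assumes "class_0_11_0 a" shows "pluecker a \<and> superint_conds a"
proof -
  obtain a1 b1 c1 a3 b3 c3 where rel: "a1 * b3 + b1 * a3 = 0" and nz: "a1 * a3 * b1 * b3 \<noteq> 0"
    and D: "\<And>z w. Dp a z w = (a1 * z + b1 * w + c1) * (a3 * z + b3 * w + c3)"
    and A: "\<And>w. Az a w = a1 * a3 * (2 * w + c3 / b3 + c1 / b1)"
    and B: "\<And>z. Bw a z = b1 * b3 * (2 * z + c3 / a3 + c1 / a1)"
    using assms unfolding class_0_11_0_def by blast
  have nz': "a1 \<noteq> 0" "a3 \<noteq> 0" "b1 \<noteq> 0" "b3 \<noteq> 0" using nz by auto
  \<comment> \<open>The centre \<open>(- g, - h)\<close> of the two lines \<open>D = 0\<close>, which are not parallel.\<close>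
  define g h p q where gh: "g = (c3 / a3 + c1 / a1) / 2" "h = (c3 / b3 + c1 / b1) / 2"
    "p = a1 * a3" "q = b1 * b3"
  have g2: "2 * g * a1 * a3 = c3 * a1 + c1 * a3" using nz' by (simp add: gh field_simps)
  have h2: "2 * h * b1 * b3 = c3 * b1 + c1 * b3" using nz' by (simp add: gh field_simps)
  \<comment> \<open>On combining \<open>g2\<close> and \<open>h2\<close>, the other constant is
    multiplied by \<open>a1 * b3 + b1 * a3\<close>, which is zero.\<close>
  have "2 * a3 * b3 * c1 = 2 * a3 * b3 * (a1 * g + b1 * h)"
    "2 * a1 * b1 * c3 = 2 * a1 * b1 * (a3 * g + b3 * h)"
    using g2 h2 rel by algebra+
  then have c: "c1 = a1 * g + b1 * h" "c3 = a3 * g + b3 * h"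
    using nz' by (simp_all only: mult_cancel_left mult_eq_0_iff) simp_all
  have A': "Az a w = 2 * p * h + 2 * p * w + 0 * w^2" for w
    unfolding A gh(2,3) by (simp add: algebra_simps)
  have B': "Bw a z = 2 * q * g + 2 * q * z + 0 * z^2" for z
    unfolding B gh(1,4) by (simp add: algebra_simps)
  \<comment> \<open>By \<open>rel\<close> the product has no mixed term and becomes
    \<open>p * (z + g)^2 + q * (w + h)^2\<close>.\<close>
  have D': "Dp a z w = (p * g^2 + q * h^2) + (2 * p * g) * z + (2 * q * h) * w + p * z^2
      + 0 * z * w + q * w^2 + 0 * z^2 * w + 0 * z * w^2" for z w
    unfolding D c gh(3,4) using rel by algebra
  note co = Dp_coeffs[OF D'] Az_coeffs[OF A'] Bw_coeffs[OF B']
  have pl: "pluecker a" unfolding pluecker_def using co by algebra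
  have e: "Dp a z w = p * (z + g)^2 + q * (w + h)^2" "Dz a z w = 2 * p * (z + g)"
     "Dw a z w = 2 * q * (w + h)" "Dzz a z w = 2 * p" "Dww a z w = 2 * q"
     "Az a w = 2 * p * (w + h)" "Bw a z = 2 * q * (z + g)" for z w
    unfolding Dp_def Dz_def Dw_def Dzz_def Dww_def Az_def Bw_def using co by algebra+
  have "superint_conds a" unfolding superint_conds_def e
    by (intro allI conjI) algebra+
  with pl show ?thesis ..
qed

theorem theorem4p5:
  fixes a :: coeffs
  shows "in_V a \<longleftrightarrow>
    nonzero_pt a \<and>
    (class_111 a \<or> class_11_0_1 a \<or> class_11_0_0 a \<or> class_0_11_0 a \<or>
     class_1_0_11 a \<or> class_0_0_11 a)"
proof -
  \<comment> \<open>Classes (5) and (6) speak about \<open>conj_pt a\<close>; since conjugation is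
    an involution, the conditions transfer back to \<open>a\<close>.\<close>
  have conj: "pluecker a \<and> superint_conds a"
    if "pluecker (conj_pt a) \<and> superint_conds (conj_pt a)"
    using that superint_conds_conj[of "conj_pt a"] by (simp add: pluecker_conj)
  show ?thesis
    unfolding in_V_def class_1_0_11_def class_0_0_11_def
    using class_if_in_V[of a, unfolded class_1_0_11_def class_0_0_11_def]
      in_V_if_class_111 in_V_if_class_11_0_1 in_V_if_class_11_0_0 in_V_if_class_0_11_0 conj
    by blast
qed

end
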